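(* For any undirected graph $G=([p],E)$ the stable set polytope $\operatorname{STAB}(G)$ fulfills the rhombus criterion.
   Context: $[p]=\{1,\dots,p\}$. A subset $A\subseteq[p]$ is stable in $G$ if the induced subgraph $G|_A$ contains no edges. The incidence vector $\chi_A\in\mathbb{R}^p$ of $A$ has $\chi_A(i)=1$ if $i\in A$ and $\chi_A(i)=0$ otherwise. $\operatorname{STAB}(G)=\operatorname{conv}(\chi_A: A\text{ is stable in }G)$. A polytope $P$ with vertex set $V$ fulfills the rhombus criterion if for every pair of distinct vertices $\alpha,\beta\in V$, either $\operatorname{conv}(\alpha,\beta)$ is an edge (1-dimensional face) of $P$, or there exist $\alpha',\beta'\in V\setminus\{\alpha,\beta\}$ with $\alpha+\beta=\alpha'+\beta'$. *)

theory Defs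
  imports "HOL-Analysis.Analysis"
begin

text \<open>
  The vertex set is the universe of a finite type, so that \<open>real ^ 'n\<close> has one coordinate
  for each vertex. A graph is given by its edge set; edges are unordered pairs
  of vertices, and a loop is the degenerate pair \<open>{u, u}\<close>.
\<close>

definition undirected_graph :: "'n::finite set set \<Rightarrow> bool" where
  "undirected_graph E \<longleftrightarrow> (\<forall>e\<in>E. \<exists>u v. e = {u, v})"

definition induced_edges :: "'n::finite set set \<Rightarrow> 'n set \<Rightarrow> 'n set set" where
  "induced_edges E A = {e \<in> E. e \<subseteq> A}"

definition stable :: "'n::finite set set \<Rightarrow> 'n set \<Rightarrow> bool" where
  "stable E A \<longleftrightarrow> induced_edges E A = {}"

definition incidence_vector :: "'n::finite set \<Rightarrow> real ^ 'n" where
  "incidence_vector A = (\<chi> i. if i \<in> A then 1 else 0)"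

definition STAB :: "'n::finite set set \<Rightarrow> (real ^ 'n) set" where
  "STAB E = convex hull {incidence_vector A | A. stable E A}"

definition vertex_set :: "'a::euclidean_space set \<Rightarrow> 'a set" where
  "vertex_set P = {v. v extreme_point_of P}"

text \<open>
  The disjunction is automatically exclusive: if \<open>\<alpha>\<close> and \<open>\<beta>\<close> span an edge, then
  \<open>\<alpha> + \<beta> = \<alpha>' + \<beta>'\<close> puts \<open>\<alpha>'\<close> and \<open>\<beta>'\<close> on that edge, whose only vertices
  are \<open>\<alpha>\<close> and \<open>\<beta>\<close>.
\<close>

definition rhombus_criterion :: "'a::euclidean_space set \<Rightarrow> bool" where
  "rhombus_criterion P \<longleftrightarrow>
     (\<forall>\<alpha>\<in>vertex_set P. \<forall>\<beta>\<in>vertex_set P. \<alpha> \<noteq> \<beta> \<longrightarrow>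
        (convex hull {\<alpha>, \<beta>}) edge_of P \<or>
        (\<exists>\<alpha>'\<in>vertex_set P - {\<alpha>, \<beta>}. \<exists>\<beta>'\<in>vertex_set P - {\<alpha>, \<beta>}. \<alpha> + \<beta> = \<alpha>' + \<beta>'))"

lemma polytope_STAB: "polytope (STAB E)"
proof -
  have "finite {incidence_vector A | A. stable E A}"
    by simp
  then show ?thesis
    unfolding STAB_def polytope_def by blast
qed

end

theory Submission
  imports Defs
begin

text \<open>
  Let \<open>A\<close> and \<open>B\<close> be stable. The smallest face of the polytope containing both incidence vectors
  is cut out by the valid inequalities \<open>x\<^sub>i \<ge> 0\<close> for \<open>i\<close> outside \<open>A \<union> B\<close>, \<open>x\<^sub>i \<le> 1\<close> for \<open>i\<close> in
  \<open>A \<inter> B\<close>, and \<open>x\<^sub>u + x\<^sub>v \<le> 1\<close> for the edges between \<open>A - B\<close> and \<open>B - A\<close>. If a stable set \<open>D\<close> other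
  than \<open>A\<close> and \<open>B\<close> attains all of these with equality, then complementing \<open>D\<close> within
  the symmetric difference of \<open>A\<close> and \<open>B\<close> gives a stable set \<open>D'\<close>, and the
  incidence vectors of \<open>D\<close> and \<open>D'\<close> have the same sum as those of \<open>A\<close> and \<open>B\<close>. Otherwise this
  face is the segment between the two vectors. The case \<open>A = B\<close> shows that every incidence
  vector of a stable set is a vertex.
\<close>

text \<open>Adding up the inequalities gives a single valid one, and a point of \<open>V\<close>
  attains it with equality only if it attains every summand with equality. So one supporting
  hyperplane cuts out the face.\<close>

lemma face_of_convex_hull_tight_inequalities:
  fixes V :: "'a::euclidean_space set"
  assumes "finite V" "finite K"
    and valid: "\<And>v c m. v \<in> V \<Longrightarrow> (c, m) \<in> K \<Longrightarrow> c \<bullet> v \<le> m"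
  shows "convex hull {v \<in> V. \<forall>(c, m) \<in> K. c \<bullet> v = m} face_of convex hull V"
proof -
  let ?c = "\<Sum>k\<in>K. fst k" and ?m = "\<Sum>k\<in>K. snd k"
  let ?T = "convex hull V \<inter> {x. ?c \<bullet> x = ?m}"
  have le: "?c \<bullet> v \<le> ?m" if "v \<in> V" for v
    unfolding inner_sum_left using that valid by (intro sum_mono) auto
  have tight: "\<forall>(c, m) \<in> K. c \<bullet> v = m" if "v \<in> V" "?c \<bullet> v = ?m" for v
  proof -
    have "fst k \<bullet> v = snd k" if "k \<in> K" for k
      by (rule sum_mono_inv[of "\<lambda>k. fst k \<bullet> v" K snd])
        (use \<open>?c \<bullet> v = ?m\<close> \<open>v \<in> V\<close> that valid \<open>finite K\<close> in \<open>auto simp: inner_sum_left\<close>)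
    then show ?thesis by auto
  qed
  have "convex hull V \<subseteq> {x. ?c \<bullet> x \<le> ?m}"
    by (intro hull_minimal convex_halfspace_le) (use le in auto)
  then have face: "?T face_of convex hull V"
    by (intro face_of_Int_supporting_hyperplane_le) auto
  \<comment> \<open>A face of the hull of finitely many points is spanned by some of them; these lie
    on the hyperplane, hence are tight.\<close>
  then obtain V' where V': "V' \<subseteq> V" "?T = convex hull V'"
    using face_of_convex_hull_subset \<open>finite V\<close> finite_imp_compact by metis
  have "V' \<subseteq> {v \<in> V. \<forall>(c, m) \<in> K. c \<bullet> v = m}"
  proof
    fix v assume "v \<in> V'"
    then have "v \<in> V" "v \<in> ?T"
      unfolding V'(2) using V'(1) by (auto intro: hull_inc)
    then show "v \<in> {v \<in> V. \<forall>(c, m) \<in> K. c \<bullet> v = m}"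
      using tight by simp
  qed
  from hull_mono[OF this] have "?T \<subseteq> convex hull {v \<in> V. \<forall>(c, m) \<in> K. c \<bullet> v = m}"
    by (simp only: V'(2))
  moreover have "convex hull {v \<in> V. \<forall>(c, m) \<in> K. c \<bullet> v = m} \<subseteq> ?T"
  proof (rule hull_minimal)
    show "{v \<in> V. \<forall>(c, m) \<in> K. c \<bullet> v = m} \<subseteq> ?T"
    proof
      fix v assume v: "v \<in> {v \<in> V. \<forall>(c, m) \<in> K. c \<bullet> v = m}"
      then have "?c \<bullet> v = ?m"
        unfolding inner_sum_left by (intro sum.cong) auto
      with v show "v \<in> ?T"
        by (simp add: hull_inc)
    qed
    show "convex ?T"
      by (intro convex_Int convex_convex_hull convex_hyperplane)
  qed
  ultimately have "?T = convex hull {v \<in> V. \<forall>(c, m) \<in> K. c \<bullet> v = m}"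
    by (rule equalityI)
  with face show ?thesis
    by (simp only:)
qed

lemma inj_incidence_vector: "inj incidence_vector"
  by (rule injI) (auto simp: incidence_vector_def vec_eq_iff split: if_splits)

lemma inner_axis_incidence_vector:
  "axis i c \<bullet> incidence_vector D = (if i \<in> D then c else 0)"
  by (simp add: inner_axis' incidence_vector_def)

lemma not_both_in_stable:
  assumes "stable E D" "{u, v} \<in> E"
  shows "u \<notin> D \<or> v \<notin> D"
  using assms by (auto simp: stable_def induced_edges_def)

text \<open>For stable \<open>D\<close> this is equality in all the chosen inequalities, put in
  terms of sets.\<close>

definition tight_for :: "'n::finite set set \<Rightarrow> 'n set \<Rightarrow> 'n set \<Rightarrow> 'n set \<Rightarrow> bool" where
  "tight_for E A B D \<longleftrightarrow> A \<inter> B \<subseteq> D \<and> D \<subseteq> A \<union> B \<and>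
     (\<forall>u\<in>A - B. \<forall>v\<in>B - A. {u, v} \<in> E \<longrightarrow> (u \<in> D \<longleftrightarrow> v \<notin> D))"

lemma face_of_STAB_tight_for:
  fixes E :: "'n::finite set set"
  shows "convex hull {incidence_vector D | D. stable E D \<and> tight_for E A B D} face_of STAB E"
proof -
  define V where "V = {incidence_vector D | D. stable E D}"
  \<comment> \<open>A pair \<open>(c, m)\<close> stands for \<open>c \<bullet> x \<le> m\<close>, so
    nonnegativity enters with its sign reversed.\<close>
  define K :: "((real ^ 'n) \<times> real) set" where
    "K = (\<lambda>i. (axis i (- 1), 0)) ` (- (A \<union> B)) \<union> (\<lambda>i. (axis i 1, 1)) ` (A \<inter> B) \<union>
         (\<Union>u\<in>A - B. (\<lambda>v. (axis u 1 + axis v 1, 1)) ` {v \<in> B - A. {u, v} \<in> E})"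
  have tight: "(\<forall>(c, m) \<in> K. c \<bullet> incidence_vector D = m) \<longleftrightarrow> tight_for E A B D"
    if "stable E D" for D
  proof -
    have "(if u \<in> D then 1 else 0) + (if v \<in> D then 1 else 0) = (1::real) \<longleftrightarrow> (u \<in> D \<longleftrightarrow> v \<notin> D)" for u v
      by simp
    then show ?thesis
      unfolding K_def tight_for_def subset_eq
      by (simp add: ball_Un inner_axis_incidence_vector inner_add_left) blast
  qed
  have "convex hull {v \<in> V. \<forall>(c, m) \<in> K. c \<bullet> v = m} face_of convex hull V"
  proof (rule face_of_convex_hull_tight_inequalities)
    show "finite V" "finite K"
      unfolding V_def K_def by simp_all
    show "c \<bullet> v \<le> m" if "v \<in> V" "(c, m) \<in> K" for v c m
    proof -
      obtain D where D: "v = incidence_vector D" "stable E D"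
        using \<open>v \<in> V\<close> by (auto simp: V_def)
      show ?thesis
        using \<open>(c, m) \<in> K\<close> not_both_in_stable[OF D(2)] unfolding K_def D(1)
        by (auto simp: inner_axis_incidence_vector inner_add_left)
    qed
  qed
  moreover have "{v \<in> V. \<forall>(c, m) \<in> K. c \<bullet> v = m} =
      {incidence_vector D | D. stable E D \<and> tight_for E A B D}"
    unfolding V_def by (rule Collect_cong) (simp only: mem_Collect_eq, metis tight)
  ultimately show ?thesis
    by (simp add: STAB_def V_def)
qed

lemma vertex_set_STAB: "vertex_set (STAB E) = {incidence_vector D | D. stable E D}"
proof (intro equalityI subsetI)
  fix v assume "v \<in> vertex_set (STAB E)"
  then show "v \<in> {incidence_vector D | D. stable E D}"
    unfolding vertex_set_def STAB_def using extreme_point_of_convex_hull by blast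
next
  fix v assume "v \<in> {incidence_vector D | D. stable E D}"
  then obtain D where D: "v = incidence_vector D" "stable E D" by blast
  \<comment> \<open>With both sets equal to \<open>D\<close>, tightness squeezes \<open>C\<close>
    between \<open>D\<close> and \<open>D\<close>.\<close>
  have "{incidence_vector C | C. stable E C \<and> tight_for E D D C} = {v}"
    using D by (auto simp: tight_for_def)
  then have "{v} face_of STAB E"
    using face_of_STAB_tight_for[of E D D] by simp
  then show "v \<in> vertex_set (STAB E)"
    by (simp add: vertex_set_def face_of_singleton)
qed

text \<open>Since \<open>A\<close> and \<open>B\<close> are stable, an edge inside the new set,
  which lies in \<open>A \<union> B\<close>, would join \<open>A - B\<close> to
  \<open>B - A\<close>. Tightness puts one of its ends in \<open>D\<close>, and that end was
  removed.\<close>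

lemma stable_swap:
  assumes "undirected_graph E" "stable E A" "stable E B" "tight_for E A B D"
  shows "stable E ((A \<union> B - D) \<union> A \<inter> B)"
proof -
  let ?D' = "(A \<union> B - D) \<union> A \<inter> B"
  have "\<not> e \<subseteq> ?D'" if "e \<in> E" for e
  proof
    assume sub: "e \<subseteq> ?D'"
    obtain u v where e: "e = {u, v}"
      using assms(1) \<open>e \<in> E\<close> by (auto simp: undirected_graph_def)
    have uv: "{u, v} \<in> E" "{v, u} \<in> E" "u \<in> ?D'" "v \<in> ?D'"
      using \<open>e \<in> E\<close> sub unfolding e by (auto simp: insert_commute)
    then have "(u \<in> A - B \<and> v \<in> B - A) \<or> (v \<in> A - B \<and> u \<in> B - A)"
      using not_both_in_stable[OF assms(2)] not_both_in_stable[OF assms(3)] by blast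
    then show False
      using uv assms(4) unfolding tight_for_def by blast
  qed
  then show ?thesis
    by (auto simp: stable_def induced_edges_def)
qed

theorem proposition4p6:
  fixes E :: "'n::finite set set"
  assumes "undirected_graph E"
  shows "rhombus_criterion (STAB E)"
  unfolding rhombus_criterion_def
proof (intro ballI impI)
  fix \<alpha> \<beta> :: "real ^ 'n"
  assume vertices: "\<alpha> \<in> vertex_set (STAB E)" "\<beta> \<in> vertex_set (STAB E)" and "\<alpha> \<noteq> \<beta>"
  obtain A where A: "\<alpha> = incidence_vector A" "stable E A"
    using vertices(1) by (auto simp: vertex_set_STAB)
  obtain B where B: "\<beta> = incidence_vector B" "stable E B"
    using vertices(2) by (auto simp: vertex_set_STAB)
  show "(convex hull {\<alpha>, \<beta>}) edge_of STAB E \<or>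
    (\<exists>\<alpha>'\<in>vertex_set (STAB E) - {\<alpha>, \<beta>}. \<exists>\<beta>'\<in>vertex_set (STAB E) - {\<alpha>, \<beta>}. \<alpha> + \<beta> = \<alpha>' + \<beta>')"
  proof (cases "\<exists>D. stable E D \<and> tight_for E A B D \<and> D \<noteq> A \<and> D \<noteq> B")
    case True
    then obtain D where D: "stable E D" "tight_for E A B D" "D \<noteq> A" "D \<noteq> B" by blast
    define D' where "D' = (A \<union> B - D) \<union> A \<inter> B"
    have between: "A \<inter> B \<subseteq> D" "D \<subseteq> A \<union> B"
      using D(2) by (auto simp: tight_for_def)
    have "stable E D'"
      unfolding D'_def by (rule stable_swap[OF assms A(2) B(2) D(2)])
    \<comment> \<open>For sets between \<open>A \<inter> B\<close> and \<open>A \<union> B\<close>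
      this complement is an involution exchanging \<open>A\<close> and \<open>B\<close>, so
      \<open>D' = A\<close> would force \<open>D = B\<close>.\<close>
    moreover have "D' \<noteq> A" "D' \<noteq> B"
      using between D(3,4) unfolding D'_def by blast+
    \<comment> \<open>\<open>D\<close> and \<open>D'\<close> share exactly
      \<open>A \<inter> B\<close> and split the symmetric difference between them, just as
      \<open>A\<close> and \<open>B\<close> do.\<close>
    moreover have "\<alpha> + \<beta> = incidence_vector D + incidence_vector D'"
      using between by (auto simp: A(1) B(1) D'_def incidence_vector_def vec_eq_iff)
    ultimately show ?thesis
      using D inj_eq[OF inj_incidence_vector]
      unfolding vertex_set_STAB A(1) B(1) by blast
  next
    case False
    have "tight_for E A B A" "tight_for E A B B"
      by (auto simp: tight_for_def)
    with False have "{incidence_vector D | D. stable E D \<and> tight_for E A B D} = {\<alpha>, \<beta>}"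
      using A B by blast
    then have "convex hull {\<alpha>, \<beta>} face_of STAB E"
      using face_of_STAB_tight_for[of E A B] by simp
    then show ?thesis
      using \<open>\<alpha> \<noteq> \<beta>\<close> by (simp add: edge_of_def aff_dim_convex_hull)
  qed
qed

end
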